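(* Let $0<\alpha\le 1$, and let the Lagrangian $L:[a,b]\times\mathbb{R}^n\times\mathbb{R}^r\to\mathbb{R}$ and the velocity vector $\varphi:[a,b]\times\mathbb{R}^n\times\mathbb{R}^r\to\mathbb{R}^n$ be $C^1$ functions with respect to all their arguments. Define the Hamiltonian $$\mathcal{H}(\theta,q,u,p)=L(\theta,q,u)(t-\theta)^{\alpha-1}+p\cdot\varphi(\theta,q,u).$$ Then the following property holds along the Pontryagin FALVA extremals $(q(\cdot),u(\cdot),p(\cdot))$: $$\frac{d\mathcal{H}}{d\theta}(\theta,q(\theta),u(\theta),p(\theta))=\partial_1\mathcal{H}(\theta,q(\theta),u(\theta),p(\theta)).$$
   Context: $\theta$ is the intrinsic time and $t$ is the observer time, with $t\ne\theta$. $\partial_i$ denotes the partial derivative with respect to the $i$-th argument; for $\mathcal{H}(\theta,q,u,p)$ the arguments $1,2,3,4$ are $\theta,q,u,p$. The dot $\cdot$ is the inner product in $\mathbb{R}^n$, and $d\mathcal{H}/d\theta$ is the total derivative of $\theta\mapsto\mathcal{H}(\theta,q(\theta),u(\theta),p(\theta))$. The underlying problem is to find the stationary values of $\frac{1}{\Gamma(\alpha)}\int_a^t L(\theta,q(\theta),u(\theta))(t-\theta)^{\alpha-1}\,d\theta$ ($\Gamma$ is the Euler gamma function) subject to the control system $\dot q(\theta)=\varphi(\theta,q(\theta),u(\theta))$ and the initial condition $q(a)=q_a$, where the control functions $u(\cdot)$ take values on an open set of $\mathbb{R}^r$. A process is a pair $(q(\cdot),u(\cdot))$ satisfying this control system and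 initial condition. A Pontryagin FALVA extremal is a tuple $(q(\cdot),u(\cdot),p(\cdot))$, with $(q(\cdot),u(\cdot))$ a process and $p(\cdot)\in C^1([a,b];\mathbb{R}^n)$, satisfying for all $\theta$ the Hamiltonian system $$\dot q(\theta)=\partial_4\mathcal{H}(\theta,q(\theta),u(\theta),p(\theta)),\qquad \dot p(\theta)=-\partial_2\mathcal{H}(\theta,q(\theta),u(\theta),p(\theta)),$$ and the stationary condition $\partial_3\mathcal{H}(\theta,q(\theta),u(\theta),p(\theta))=0$.
   Formalization: The identity is asserted at those times θ in [a,t) (with a < t ≤ b) at which the control u is differentiable; without regularity of u it can fail, e.g. when u jumps between critical points of L with different values. *)

theory Defs
  imports "HOL-Analysis.Analysis"
begin

(* Continuous Frechet differentiability relative to S, so that one-sided derivatives are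
   meant at the boundary of S. The library predicate C1_differentiable_on is restricted to
   functions of one real variable and asks for two-sided derivatives at end points. *)
definition cont_diff_on ::
  "('a::real_normed_vector \<Rightarrow> 'b::real_normed_vector) \<Rightarrow> 'a set \<Rightarrow> bool"
where
  "cont_diff_on f S \<longleftrightarrow>
     (\<exists>f' :: 'a \<Rightarrow> 'a \<Rightarrow>\<^sub>L 'b.
        (\<forall>x\<in>S. (f has_derivative blinfun_apply (f' x)) (at x within S)) \<and>
        continuous_on S f')"

definition grad :: "('a::real_inner \<Rightarrow> real) \<Rightarrow> 'a \<Rightarrow> 'a" where
  "grad f x = (THE D. GDERIV f x :> D)"

(* T is the range of the time argument; the derivative in time is one-sided at an end
   point that belongs to T. *)
definition partial1 ::
  "real set \<Rightarrow> (real \<Rightarrow> 'q \<Rightarrow> 'u \<Rightarrow> 'p \<Rightarrow> real) \<Rightarrow> real \<Rightarrow> 'q \<Rightarrow> 'u \<Rightarrow> 'p \<Rightarrow> real"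
where
  "partial1 T H \<theta> q u p = vector_derivative (\<lambda>s. H s q u p) (at \<theta> within T)"

definition partial2 ::
  "(real \<Rightarrow> 'q::real_inner \<Rightarrow> 'u \<Rightarrow> 'p \<Rightarrow> real) \<Rightarrow> real \<Rightarrow> 'q \<Rightarrow> 'u \<Rightarrow> 'p \<Rightarrow> 'q"
where
  "partial2 H \<theta> q u p = grad (\<lambda>y. H \<theta> y u p) q"

definition partial3 ::
  "(real \<Rightarrow> 'q \<Rightarrow> 'u::real_inner \<Rightarrow> 'p \<Rightarrow> real) \<Rightarrow> real \<Rightarrow> 'q \<Rightarrow> 'u \<Rightarrow> 'p \<Rightarrow> 'u"
where
  "partial3 H \<theta> q u p = grad (\<lambda>v. H \<theta> q v p) u"

definition partial4 ::
  "(real \<Rightarrow> 'q \<Rightarrow> 'u \<Rightarrow> 'p::real_inner \<Rightarrow> real) \<Rightarrow> real \<Rightarrow> 'q \<Rightarrow> 'u \<Rightarrow> 'p \<Rightarrow> 'p"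
where
  "partial4 H \<theta> q u p = grad (\<lambda>z. H \<theta> q u z) p"

(* Used only for intrinsic times \<theta> < t, where the base of the power is positive. *)
definition hamiltonian ::
  "real \<Rightarrow> real \<Rightarrow> (real \<Rightarrow> real^'n \<Rightarrow> real^'r \<Rightarrow> real) \<Rightarrow>
   (real \<Rightarrow> real^'n \<Rightarrow> real^'r \<Rightarrow> real^'n) \<Rightarrow>
   real \<Rightarrow> real^'n \<Rightarrow> real^'r \<Rightarrow> real^'n \<Rightarrow> real"
where
  "hamiltonian \<alpha> t L \<phi> \<theta> q u p = L \<theta> q u * (t - \<theta>) powr (\<alpha> - 1) + p \<bullet> \<phi> \<theta> q u"

(* The intrinsic time runs over the interval of integration without the singular point
   \<theta> = t. The controls take values in U and no regularity in time is imposed on them. *)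
definition process ::
  "real \<Rightarrow> real \<Rightarrow> (real \<Rightarrow> real^'n \<Rightarrow> real^'r \<Rightarrow> real^'n) \<Rightarrow> real^'n \<Rightarrow> (real^'r) set \<Rightarrow>
   (real \<Rightarrow> real^'n) \<Rightarrow> (real \<Rightarrow> real^'r) \<Rightarrow> bool"
where
  "process a t \<phi> qa U q u \<longleftrightarrow>
     q a = qa \<and>
     (\<forall>\<theta>\<in>{a..<t}. u \<theta> \<in> U \<and>
        (q has_vector_derivative \<phi> \<theta> (q \<theta>) (u \<theta>)) (at \<theta> within {a..<t}))"

definition pontryagin_falva_extremal ::
  "real \<Rightarrow> real \<Rightarrow> real \<Rightarrow> real \<Rightarrow> (real \<Rightarrow> real^'n \<Rightarrow> real^'r \<Rightarrow> real) \<Rightarrow>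
   (real \<Rightarrow> real^'n \<Rightarrow> real^'r \<Rightarrow> real^'n) \<Rightarrow> real^'n \<Rightarrow> (real^'r) set \<Rightarrow>
   (real \<Rightarrow> real^'n) \<Rightarrow> (real \<Rightarrow> real^'r) \<Rightarrow> (real \<Rightarrow> real^'n) \<Rightarrow> bool"
where
  "pontryagin_falva_extremal a b \<alpha> t L \<phi> qa U q u p \<longleftrightarrow>
     process a t \<phi> qa U q u \<and>
     cont_diff_on p {a..b} \<and>
     (let H = hamiltonian \<alpha> t L \<phi> in
       \<forall>\<theta>\<in>{a..<t}.
         (q has_vector_derivative partial4 H \<theta> (q \<theta>) (u \<theta>) (p \<theta>)) (at \<theta> within {a..<t}) \<and>
         (p has_vector_derivative - partial2 H \<theta> (q \<theta>) (u \<theta>) (p \<theta>)) (at \<theta> within {a..<t}) \<and>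
         partial3 H \<theta> (q \<theta>) (u \<theta>) (p \<theta>) = 0)"

end

theory Submission
  imports Defs
begin

text \<open>
  Regard the Hamiltonian as one function of the tuple \<open>(\<theta>, q, u, p)\<close>. For \<open>\<theta> < t\<close> it is
  differentiable, because \<open>L\<close> and \<open>\<phi>\<close> are and the base of the power \<open>(t - \<theta>) powr (\<alpha> - 1)\<close>
  is positive. At a time where the control is differentiable, the chain rule gives
  \<open>dH/d\<theta> = \<partial>\<^sub>1H + \<partial>\<^sub>2H \<bullet> q' + \<partial>\<^sub>3H \<bullet> u' + \<partial>\<^sub>4H \<bullet> p'\<close>. The stationary condition removes the
  third summand, and the Hamiltonian system \<open>q' = \<partial>\<^sub>4H\<close>, \<open>p' = -\<partial>\<^sub>2H\<close> makes the second and
  the fourth cancel, so that only \<open>\<partial>\<^sub>1H\<close> remains. This cancellation holds for every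
  differentiable Hamiltonian (lemma \<open>has_real_derivative_along_extremal\<close>); the form of the
  Hamiltonian enters only through lemma \<open>hamiltonian_differentiable\<close>.
\<close>

text \<open>
  The description that defines \<open>grad\<close> denotes: on a Euclidean space the linear functional \<open>f'\<close>
  is represented by exactly one vector, namely \<open>adjoint f' 1\<close>.
\<close>

lemma inner_grad_eq:
  fixes f :: "'a::euclidean_space \<Rightarrow> real"
  assumes "(f has_derivative f') (at x)"
  shows "grad f x \<bullet> h = f' h"
proof -
  have lin: "linear f'"
    using assms by (rule has_derivative_linear)
  have repr: "f' = (\<lambda>h. h \<bullet> adjoint f' 1)"
    using adjoint_works[OF lin] by (auto simp: fun_eq_iff)
  have "GDERIV f x :> adjoint f' 1"
    unfolding gderiv_def using assms repr by metis
  moreover have "D = adjoint f' 1" if "GDERIV f x :> D" for D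
  proof -
    have "(\<lambda>h. h \<bullet> D) = f'"
      using that assms has_derivative_unique unfolding gderiv_def by blast
    then have "\<forall>h. h \<bullet> D = h \<bullet> adjoint f' 1"
      using repr by metis
    then show ?thesis
      by (simp only: vector_eq_ldot)
  qed
  ultimately have "grad f x = adjoint f' 1"
    unfolding grad_def by (rule the_equality)
  then show ?thesis
    using repr by (metis inner_commute)
qed

text \<open>
  The time derivative is taken within \<open>T\<close>, the other partial derivatives are two-sided; hence
  differentiability is required within \<open>T \<times> UNIV\<close>.
\<close>

lemma has_real_derivative_along_extremal:
  fixes H :: "real \<Rightarrow> 'q::euclidean_space \<Rightarrow> 'u::euclidean_space \<Rightarrow> 'q \<Rightarrow> real"
  assumes diff: "(\<lambda>(s, y, v, z). H s y v z) differentiable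
                   (at (\<theta>, q \<theta>, u \<theta>, p \<theta>) within T \<times> UNIV)"
    and \<theta>: "\<theta> \<in> T" "at \<theta> within T \<noteq> bot"
    and q: "(q has_vector_derivative partial4 H \<theta> (q \<theta>) (u \<theta>) (p \<theta>)) (at \<theta> within T)"
    and p: "(p has_vector_derivative - partial2 H \<theta> (q \<theta>) (u \<theta>) (p \<theta>)) (at \<theta> within T)"
    and stationary: "partial3 H \<theta> (q \<theta>) (u \<theta>) (p \<theta>) = 0"
    and u: "u differentiable (at \<theta> within T)"
  shows "((\<lambda>s. H s (q s) (u s) (p s)) has_real_derivative
            partial1 T H \<theta> (q \<theta>) (u \<theta>) (p \<theta>)) (at \<theta> within T)"
proof -
  let ?G = "\<lambda>(s, y, v, z). H s y v z"
  let ?x = "(\<theta>, q \<theta>, u \<theta>, p \<theta>)"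
  let ?P1 = "partial1 T H \<theta> (q \<theta>) (u \<theta>) (p \<theta>)"
  let ?P2 = "partial2 H \<theta> (q \<theta>) (u \<theta>) (p \<theta>)"
  let ?P3 = "partial3 H \<theta> (q \<theta>) (u \<theta>) (p \<theta>)"
  let ?P4 = "partial4 H \<theta> (q \<theta>) (u \<theta>) (p \<theta>)"
  obtain D where D: "(?G has_derivative D) (at ?x within T \<times> UNIV)"
    using diff unfolding differentiable_def by blast
  have lin: "linear D"
    using D by (rule has_derivative_linear)
  have chain: "((\<lambda>s. ?G (g s)) has_derivative (\<lambda>h. D (g' h))) (at y within S)"
    if "(g has_derivative g') (at y within S)" "g y = ?x" "g ` S \<subseteq> T \<times> UNIV"
    for g g' S and y :: "'c::real_normed_vector"
    using has_derivative_in_compose[OF that(1), of ?G D]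
      has_derivative_subset[OF D that(3)] that(2) by simp

  have "((\<lambda>s. (s, q \<theta>, u \<theta>, p \<theta>)) has_derivative (\<lambda>h. (h, 0, 0, 0))) (at \<theta> within T)"
    unfolding zero_prod_def[symmetric]
    by (intro has_derivative_Pair has_derivative_ident has_derivative_const)
  then have "((\<lambda>s. ?G (s, q \<theta>, u \<theta>, p \<theta>)) has_derivative (\<lambda>h. D (h, 0, 0, 0))) (at \<theta> within T)"
    by (rule chain) auto
  moreover have "h *\<^sub>R D (1, 0, 0, 0) = D (h, 0, 0, 0)" for h
    using linear_scale[OF lin, of h "(1, 0, 0, 0)"] by simp
  ultimately have "((\<lambda>s. H s (q \<theta>) (u \<theta>) (p \<theta>)) has_vector_derivative D (1, 0, 0, 0))
               (at \<theta> within T)"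
    \<comment> \<open>Keeping \<open>*\<^sub>R\<close> on the reals lets the previous equation rewrite the scaled value.\<close>
    unfolding has_vector_derivative_def by (simp del: real_scaleR_def)
  then have D1: "D (1, 0, 0, 0) = ?P1"
    unfolding partial1_def using \<theta>(2) by (simp add: vector_derivative_within)

  have "((\<lambda>y. (\<theta>, y, u \<theta>, p \<theta>)) has_derivative (\<lambda>h. (0, h, 0, 0))) (at (q \<theta>))"
    by (intro has_derivative_Pair has_derivative_ident has_derivative_const)
  then have "((\<lambda>y. ?G (\<theta>, y, u \<theta>, p \<theta>)) has_derivative (\<lambda>h. D (0, h, 0, 0))) (at (q \<theta>))"
    by (rule chain) (use \<theta>(1) in auto)
  then have D2: "D (0, h, 0, 0) = ?P2 \<bullet> h" for h
    unfolding partial2_def by (simp add: inner_grad_eq)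

  have "((\<lambda>v. (\<theta>, q \<theta>, v, p \<theta>)) has_derivative (\<lambda>h. (0, 0, h, 0))) (at (u \<theta>))"
    by (intro has_derivative_Pair has_derivative_ident has_derivative_const)
  then have "((\<lambda>v. ?G (\<theta>, q \<theta>, v, p \<theta>)) has_derivative (\<lambda>h. D (0, 0, h, 0))) (at (u \<theta>))"
    by (rule chain) (use \<theta>(1) in auto)
  then have D3: "D (0, 0, h, 0) = ?P3 \<bullet> h" for h
    unfolding partial3_def by (simp add: inner_grad_eq)

  have "((\<lambda>z. (\<theta>, q \<theta>, u \<theta>, z)) has_derivative (\<lambda>h. (0, 0, 0, h))) (at (p \<theta>))"
    by (intro has_derivative_Pair has_derivative_ident has_derivative_const)
  then have "((\<lambda>z. ?G (\<theta>, q \<theta>, u \<theta>, z)) has_derivative (\<lambda>h. D (0, 0, 0, h))) (at (p \<theta>))"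
    by (rule chain) (use \<theta>(1) in auto)
  then have D4: "D (0, 0, 0, h) = ?P4 \<bullet> h" for h
    unfolding partial4_def by (simp add: inner_grad_eq)

  obtain u' where u': "(u has_vector_derivative u') (at \<theta> within T)"
    using u vector_derivative_works by blast
  \<comment> \<open>The velocity of the extremal is split into its components along the four arguments.\<close>
  have "D (1, ?P4, u', - ?P2)
          = D ((1, 0, 0, 0) + (0, ?P4, 0, 0) + (0, 0, u', 0) + (0, 0, 0, - ?P2))"
    by simp
  also have "\<dots> = ?P1 + ?P2 \<bullet> ?P4 + ?P3 \<bullet> u' + ?P4 \<bullet> (- ?P2)"
    by (simp only: linear_add[OF lin] D1 D2 D3 D4)
  also have "\<dots> = ?P1"
    using stationary by (simp add: inner_commute)
  finally have total: "D (1, ?P4, u', - ?P2) = ?P1" .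

  have "((\<lambda>s. (s, q s, u s, p s)) has_derivative
           (\<lambda>h. (h, h *\<^sub>R ?P4, h *\<^sub>R u', h *\<^sub>R (- ?P2)))) (at \<theta> within T)"
    using q p u' unfolding has_vector_derivative_def
    by (intro has_derivative_Pair has_derivative_ident)
  then have "((\<lambda>s. ?G (s, q s, u s, p s)) has_derivative
           (\<lambda>h. D (h, h *\<^sub>R ?P4, h *\<^sub>R u', h *\<^sub>R (- ?P2)))) (at \<theta> within T)"
    by (rule chain) auto
  moreover have "D (h, h *\<^sub>R ?P4, h *\<^sub>R u', h *\<^sub>R (- ?P2)) = ?P1 * h" for h
    using linear_scale[OF lin, of h "(1, ?P4, u', - ?P2)"] total by simp
  ultimately show ?thesis
    by (simp add: has_field_derivative_def)
qed

lemma cont_diff_on_imp_differentiable_within: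
  assumes "cont_diff_on f S" "x \<in> R" "R \<subseteq> S"
  shows "f differentiable (at x within R)"
  using assms unfolding cont_diff_on_def differentiable_def
  by (meson has_derivative_subset subsetD)

lemma hamiltonian_differentiable:
  fixes L :: "real \<Rightarrow> real^'n \<Rightarrow> real^'r \<Rightarrow> real"
    and \<phi> :: "real \<Rightarrow> real^'n \<Rightarrow> real^'r \<Rightarrow> real^'n"
  assumes L: "(\<lambda>(\<theta>, x, v). L \<theta> x v) differentiable (at (\<theta>, x, v) within T \<times> UNIV)"
    and \<phi>: "(\<lambda>(\<theta>, x, v). \<phi> \<theta> x v) differentiable (at (\<theta>, x, v) within T \<times> UNIV)"
    and \<theta>: "\<theta> \<in> T" "\<theta> < t"
  shows "(\<lambda>(s, y, w, z). hamiltonian \<alpha> t L \<phi> s y w z) differentiable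
           (at (\<theta>, x, v, z) within T \<times> UNIV)"
proof -
  let ?\<pi> = "\<lambda>X :: real \<times> (real^'n) \<times> (real^'r) \<times> (real^'n). (fst X, fst (snd X), fst (snd (snd X)))"
  let ?F = "at (\<theta>, x, v, z) within T \<times> (UNIV :: ((real^'n) \<times> (real^'r) \<times> (real^'n)) set)"
  have proj: "?\<pi> differentiable ?F"
    unfolding differentiable_def by (rule exI) (rule derivative_intros)+
  have image: "?\<pi> ` (T \<times> UNIV) \<subseteq> T \<times> UNIV"
    by auto
  have comp: "(\<lambda>X. f (?\<pi> X)) differentiable ?F"
    if "f differentiable (at (\<theta>, x, v) within T \<times> UNIV)"
    for f :: "real \<times> (real^'n) \<times> (real^'r) \<Rightarrow> 'c::real_normed_vector"
    using differentiable_chain_within[OF proj, of f] differentiable_within_subset[OF that image]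
    by (simp add: o_def)
  obtain L' where L': "((\<lambda>X. L (fst X) (fst (snd X)) (fst (snd (snd X)))) has_derivative L') ?F"
    using comp[OF L] by (auto simp: differentiable_def)
  obtain \<phi>' where \<phi>':
    "((\<lambda>X. \<phi> (fst X) (fst (snd X)) (fst (snd (snd X)))) has_derivative \<phi>') ?F"
    using comp[OF \<phi>] by (auto simp: differentiable_def)
  have base: "((\<lambda>X. t - fst X) has_derivative (\<lambda>h. - fst h)) ?F"
    by (auto intro!: derivative_eq_intros)
  obtain W where W: "((\<lambda>X. (t - fst X) powr (\<alpha> - 1)) has_derivative W) ?F"
    using has_derivative_powr[OF base has_derivative_const] \<theta> by fastforce
  have momentum: "((\<lambda>X. snd (snd (snd X))) has_derivative (\<lambda>h. snd (snd (snd h)))) ?F"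
    by (auto intro!: derivative_eq_intros)
  show ?thesis
    unfolding hamiltonian_def case_prod_unfold differentiable_def
    using has_derivative_add[OF has_derivative_mult[OF L' W] has_derivative_inner[OF momentum \<phi>']]
    by blast
qed

theorem theorem19:
  fixes a b t \<alpha> :: real
    and L :: "real \<Rightarrow> real^'n \<Rightarrow> real^'r \<Rightarrow> real"
    and \<phi> :: "real \<Rightarrow> real^'n \<Rightarrow> real^'r \<Rightarrow> real^'n"
    and qa :: "real^'n" and U :: "(real^'r) set"
    and q p :: "real \<Rightarrow> real^'n" and u :: "real \<Rightarrow> real^'r"
  assumes "a < t" and "t \<le> b"
    and "0 < \<alpha>" and "\<alpha> \<le> 1"
    and "cont_diff_on (\<lambda>(\<theta>, x, v). L \<theta> x v) ({a..b} \<times> UNIV \<times> UNIV)"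
    and "cont_diff_on (\<lambda>(\<theta>, x, v). \<phi> \<theta> x v) ({a..b} \<times> UNIV \<times> UNIV)"
    and "open U"
    and "pontryagin_falva_extremal a b \<alpha> t L \<phi> qa U q u p"
  shows "\<forall>\<theta>\<in>{a..<t}. u differentiable (at \<theta> within {a..<t}) \<longrightarrow>
           ((\<lambda>s. hamiltonian \<alpha> t L \<phi> s (q s) (u s) (p s)) has_real_derivative
              partial1 {a..<t} (hamiltonian \<alpha> t L \<phi>) \<theta> (q \<theta>) (u \<theta>) (p \<theta>))
             (at \<theta> within {a..<t})"
proof (intro ballI impI)
  fix \<theta>
  assume \<theta>: "\<theta> \<in> {a..<t}" and u: "u differentiable (at \<theta> within {a..<t})"
  have sub: "{a..<t} \<times> UNIV \<subseteq> {a..b} \<times> (UNIV \<times> UNIV :: ((real^'n) \<times> (real^'r)) set)"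
    using assms(2) by auto
  have "(\<lambda>(s, y, v, z). hamiltonian \<alpha> t L \<phi> s y v z) differentiable
          (at (\<theta>, q \<theta>, u \<theta>, p \<theta>) within {a..<t} \<times> UNIV)"
    by (intro hamiltonian_differentiable cont_diff_on_imp_differentiable_within[OF assms(5) _ sub]
          cont_diff_on_imp_differentiable_within[OF assms(6) _ sub]) (use \<theta> in auto)
  moreover have "at \<theta> within {a..<t} \<noteq> bot"
    using \<theta> by (simp add: trivial_limit_within islimpt_Ico)
  ultimately show "((\<lambda>s. hamiltonian \<alpha> t L \<phi> s (q s) (u s) (p s)) has_real_derivative
      partial1 {a..<t} (hamiltonian \<alpha> t L \<phi>) \<theta> (q \<theta>) (u \<theta>) (p \<theta>)) (at \<theta> within {a..<t})"
    using \<theta> u assms(8) unfolding pontryagin_falva_extremal_def Let_def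
    by (intro has_real_derivative_along_extremal) auto
qed

end
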